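(* Let $d\ge 1$ and $R\ge 0$ be fixed integers. For each $N\in\mathbb{N}$ let $\Gamma_N=\{1,\dots,N\}^d$, let $\mathcal{A}_{\Gamma_N}$ be the Dirichlet-truncated adjacency matrix on $\Gamma_N$, and let $\{\psi_N^{(j)}\}_{j=1}^{N^d}$ be an orthonormal basis of $\ell^2(\Gamma_N)$ consisting of eigenfunctions of $\mathcal{A}_{\Gamma_N}$. Let $K_N:\Gamma_N\times\Gamma_N\to\mathbb{C}$, $N\in\mathbb{N}$, be a sequence of observables such that (i) $K_N(x,y)=0$ for all $N\in\mathbb{N}$ and all $x,y\in\Gamma_N$ with $\|x-y\|_1>R$; (ii) $|K_N(x,y)|\le 1$ for all $N\in\mathbb{N}$ and all $x,y\in\Gamma_N$. Then $$\lim_{N\to\infty}\frac{1}{N^d}\sum_{j=1}^{N^d}\left|\langle\psi_N^{(j)},K_N\psi_N^{(j)}\rangle-\langle K_N\rangle_{\psi_N^{(j)}}\right|^2=0,$$ where $\langle K\rangle_\psi$ is the eigenfunction correlator defined in the context. (In particular, for $R=0$ one has $\langle K_N\rangle_{\psi_N^{(j)}}=\frac{1}{\#\Gamma_N}\sum_{x\in\Gamma_N}K_N(x,x)$, and the statement is quantum ergodicity for diagonal observables.)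
   Context: $\mathbb{N}$ denotes the positive integers. $\ell^2(\Gamma_N)$ is the space of functions $\Gamma_N\to\mathbb{C}$ with inner product $\langle\varphi,\psi\rangle=\sum_{x\in\Gamma_N}\overline{\varphi(x)}\psi(x)$. The Dirichlet-truncated adjacency matrix is $(\mathcal{A}_{\Gamma_N}\psi)(x)=\sum_{y\in\Gamma_N,\ \|y-x\|_1=1}\psi(y)$ for $x\in\Gamma_N$, where $\|\cdot\|_1$ is the $\ell^1$-norm on $\mathbb{Z}^d$. An observable $K:\Gamma_N\times\Gamma_N\to\mathbb{C}$ acts by $(K\psi)(x)=\sum_{y\in\Gamma_N}K(x,y)\psi(y)$. For $z\in\mathbb{Z}^d$ put $L_z:=\{x\in\Gamma_N: x+z\in\Gamma_N\}$ and, for $\psi\in\ell^2(\Gamma_N)$ and $x\in\Gamma_N$, $(\rho_z\psi)(x):=\psi(x+z)$ if $x+z\in\Gamma_N$ and $(\rho_z\psi)(x):=0$ otherwise. For an observable $K$ on $\Gamma_N$ and $\psi\in\ell^2(\Gamma_N)$, $$\langle K\rangle_\psi:=\sum_{z}\ \sum_{x\in L_z}\frac{1}{\#L_z}K(x,x+z)\,\langle\psi,\rho_z\psi\rangle,$$ the outer sum being over all $z\in\mathbb{Z}^d$ with $L_z\neq\emptyset$. *)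

theory Defs
  imports "HOL-Analysis.Analysis"
begin

text \<open>
  The lattice is \<open>int ^ 'd\<close>, its dimension \<open>CARD('d) \<ge> 1\<close>.  Functions on the box are total functions
  on the lattice; no definition below reads their values outside the box.
\<close>

definition box_lattice :: "nat \<Rightarrow> (int ^ 'd::finite) set" where
  "box_lattice N = {x. \<forall>i. 1 \<le> x $ i \<and> x $ i \<le> int N}"

definition l1_norm :: "int ^ 'd::finite \<Rightarrow> int" where
  "l1_norm x = (\<Sum>i\<in>UNIV. \<bar>x $ i\<bar>)"

definition box_inner ::
  "nat \<Rightarrow> (int ^ 'd::finite \<Rightarrow> complex) \<Rightarrow> (int ^ 'd \<Rightarrow> complex) \<Rightarrow> complex" where
  "box_inner N \<phi> \<psi> = (\<Sum>x\<in>box_lattice N. cnj (\<phi> x) * \<psi> x)"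

definition adjacency ::
  "nat \<Rightarrow> (int ^ 'd::finite \<Rightarrow> complex) \<Rightarrow> int ^ 'd \<Rightarrow> complex" where
  "adjacency N \<psi> x = (\<Sum>y | y \<in> box_lattice N \<and> l1_norm (y - x) = 1. \<psi> y)"

definition obs_apply ::
  "nat \<Rightarrow> (int ^ 'd::finite \<Rightarrow> int ^ 'd \<Rightarrow> complex) \<Rightarrow> (int ^ 'd \<Rightarrow> complex) \<Rightarrow> int ^ 'd \<Rightarrow> complex"
  where "obs_apply N K \<psi> x = (\<Sum>y\<in>box_lattice N. K x y * \<psi> y)"

definition is_eigenfunction :: "nat \<Rightarrow> (int ^ 'd::finite \<Rightarrow> complex) \<Rightarrow> bool" where
  "is_eigenfunction N \<psi> \<longleftrightarrow>
     (\<exists>x\<in>box_lattice N. \<psi> x \<noteq> 0) \<and>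
     (\<exists>\<mu>::complex. \<forall>x\<in>box_lattice N. adjacency N \<psi> x = \<mu> * \<psi> x)"

definition is_orthonormal_basis ::
  "nat \<Rightarrow> nat set \<Rightarrow> (nat \<Rightarrow> int ^ 'd::finite \<Rightarrow> complex) \<Rightarrow> bool" where
  "is_orthonormal_basis N J \<psi> \<longleftrightarrow>
     (\<forall>j\<in>J. \<forall>k\<in>J. box_inner N (\<psi> j) (\<psi> k) = (if j = k then 1 else 0)) \<and>
     (\<forall>\<phi>. \<exists>c. \<forall>x\<in>box_lattice N. \<phi> x = (\<Sum>j\<in>J. c j * \<psi> j x))"

definition shift_dom :: "nat \<Rightarrow> int ^ 'd::finite \<Rightarrow> (int ^ 'd) set" where
  "shift_dom N z = {x \<in> box_lattice N. x + z \<in> box_lattice N}"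

definition shift ::
  "nat \<Rightarrow> int ^ 'd::finite \<Rightarrow> (int ^ 'd \<Rightarrow> complex) \<Rightarrow> int ^ 'd \<Rightarrow> complex" where
  "shift N z \<psi> x = (if x + z \<in> box_lattice N then \<psi> (x + z) else 0)"

definition correlator ::
  "nat \<Rightarrow> (int ^ 'd::finite \<Rightarrow> int ^ 'd \<Rightarrow> complex) \<Rightarrow> (int ^ 'd \<Rightarrow> complex) \<Rightarrow> complex" where
  "correlator N K \<psi> =
     (\<Sum>z | shift_dom N z \<noteq> {}. \<Sum>x\<in>shift_dom N z.
        1 / of_nat (card (shift_dom N z)) * K x (x + z) * box_inner N \<psi> (shift N z \<psi>))"

text \<open>All sums above range over finite sets, so none of them is \<open>0\<close> by convention.\<close>

lemma box_lattice_eq: "(box_lattice N :: (int ^ 'd::finite) set) = vec_lambda ` (UNIV \<rightarrow>\<^sub>E {1..int N})"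
  unfolding box_lattice_def
proof (intro set_eqI iffI)
  fix x :: "int ^ 'd"
  assume "x \<in> {x. \<forall>i. 1 \<le> x $ i \<and> x $ i \<le> int N}"
  then have "vec_nth x \<in> UNIV \<rightarrow>\<^sub>E {1..int N}" by auto
  then show "x \<in> vec_lambda ` (UNIV \<rightarrow>\<^sub>E {1..int N})"
    by (metis image_eqI vec_nth_inverse)
qed (auto simp: PiE_iff)

lemma finite_box_lattice: "finite (box_lattice N :: (int ^ 'd::finite) set)"
  unfolding box_lattice_eq by (intro finite_imageI finite_PiE) auto

lemma card_box_lattice: "card (box_lattice N :: (int ^ 'd::finite) set) = N ^ CARD('d)"
proof -
  have "inj_on (vec_lambda :: ('d \<Rightarrow> int) \<Rightarrow> _) (UNIV \<rightarrow>\<^sub>E {1..int N})"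
    by (auto simp: inj_on_def vec_lambda_inject)
  then show ?thesis
    unfolding box_lattice_eq by (simp add: card_image card_PiE)
qed

lemma finite_shift_dom: "finite (shift_dom N z)"
  by (rule finite_subset[OF _ finite_box_lattice]) (auto simp: shift_dom_def)

lemma finite_shifts: "finite {z :: int ^ 'd::finite. shift_dom N z \<noteq> {}}"
proof (rule finite_subset)
  show "{z :: int ^ 'd. shift_dom N z \<noteq> {}} \<subseteq> (\<lambda>(x, y). y - x) ` (box_lattice N \<times> box_lattice N)"
    by (force simp: shift_dom_def image_iff)
qed (simp add: finite_box_lattice)

end

theory Submission
  imports Defs
begin

text \<open>
  With \<open>\<theta> = \<pi> / (N + 1)\<close>, the sine waves \<open>s\<^sub>k(x) = \<Prod>\<^sub>i sin (\<theta> k\<^sub>i x\<^sub>i)\<close> satisfy \<open>A s\<^sub>k = \<lambda>\<^sub>k s\<^sub>k\<close> with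
  \<open>\<lambda>\<^sub>k = \<Sum>\<^sub>i 2 cos (\<theta> k\<^sub>i)\<close>, so an eigenfunction only has sine coefficients \<open>c\<^sub>k\<close> on one level set of
  \<open>\<lambda>\<close>.  On the box it equals \<open>\<Sum>\<^sub>k c\<^sub>k exp (i \<theta> k \<bullet> x)\<close> up to a constant, \<open>k\<close> ranging over a full period
  of length \<open>2 (N + 1)\<close> in each coordinate.  For an observable supported on \<open>y = x + z\<close> with entries
  \<open>b(x)\<close> of mean zero, \<open>\<langle>\<psi>, K \<psi>\<rangle>\<close> is therefore a quadratic form in \<open>c\<close> whose matrix is \<open>b^(l - k)\<close> up to a phase,
  restricted to \<open>\<lambda>\<^sub>k = \<lambda>\<^sub>l\<close>, and Bessel's inequality bounds the sum over the basis by the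
  Hilbert-Schmidt norm of this matrix.  The term \<open>l = k\<close> vanishes because \<open>b\<close> has mean zero.  For
  \<open>m = l - k\<close> with \<open>m\<^sub>i \<noteq> 0\<close>, fixing all \<open>k\<^sub>j\<close> with \<open>j \<noteq> i\<close> turns \<open>\<lambda>\<^sub>k = \<lambda>\<^sub>k\<^sub>+\<^sub>m\<close> into a quadratic equation for
  \<open>exp (i \<theta> k\<^sub>i)\<close>, so there are \<open>O(N\<^sup>d\<^sup>-\<^sup>1)\<close> such \<open>k\<close>; with Parseval's identity for \<open>b^\<close> the
  variance is \<open>O(1/N)\<close>.
\<close>


section \<open>Products of integer sets and sums over them\<close>

text \<open>The sides may differ by coordinate because a later count pins one coordinate to a single
  value.\<close>

definition vec_box :: "('d::finite \<Rightarrow> int set) \<Rightarrow> (int ^ 'd) set" where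
  "vec_box A = {x. \<forall>i. x $ i \<in> A i}"

lemma vec_box_eq:
  fixes A :: "'d::finite \<Rightarrow> int set"
  shows "vec_box A = vec_lambda ` Pi\<^sub>E UNIV A"
proof (intro set_eqI iffI)
  fix x :: "int ^ 'd"
  assume "x \<in> vec_box A"
  then have "vec_nth x \<in> Pi\<^sub>E UNIV A" by (auto simp: vec_box_def)
  then show "x \<in> vec_lambda ` Pi\<^sub>E UNIV A"
    by (metis image_eqI vec_nth_inverse)
qed (auto simp: PiE_iff vec_box_def)

lemma finite_vec_box: "(\<And>i. finite (A i)) \<Longrightarrow> finite (vec_box A)"
  unfolding vec_box_eq by (intro finite_imageI finite_PiE) auto

lemma sum_vec_box_prod:
  fixes f :: "'d::finite \<Rightarrow> int \<Rightarrow> 'a::comm_semiring_1"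
  assumes "\<And>i. finite (A i)"
  shows "(\<Sum>x\<in>vec_box A. \<Prod>i\<in>UNIV. f i (x $ i)) = (\<Prod>i\<in>UNIV. \<Sum>t\<in>A i. f i t)"
proof -
  have inj: "inj_on (vec_lambda :: ('d \<Rightarrow> int) \<Rightarrow> _) (Pi\<^sub>E UNIV A)"
    by (auto simp: inj_on_def vec_lambda_inject)
  have "(\<Prod>i\<in>UNIV. \<Sum>t\<in>A i. f i t) = (\<Sum>g\<in>Pi\<^sub>E UNIV A. \<Prod>i\<in>UNIV. f i (g i))"
    using assms by (intro prod_sum_PiE) auto
  then show ?thesis
    unfolding vec_box_eq by (simp add: sum.reindex[OF inj] vec_lambda_beta)
qed

lemma card_vec_box:
  assumes "\<And>i. finite (A i)"
  shows "card (vec_box A) = (\<Prod>i\<in>UNIV. card (A i))"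
  using sum_vec_box_prod[of A "\<lambda>_ _. 1 :: nat"] assms by simp

lemma sum_telescope_int:
  fixes g :: "int \<Rightarrow> 'a::ab_group_add"
  shows "(\<Sum>t\<in>{a..<a + int n}. g (t + 1) - g t) = g (a + int n) - g a"
proof (induction n)
  case (Suc n)
  have "{a..<a + int (Suc n)} = insert (a + int n) {a..<a + int n}" by auto
  with Suc show ?case by (simp add: algebra_simps)
qed simp

section \<open>Complete sums of exponentials modulo 2 (N + 1)\<close>

text \<open>Sines vanishing at 0 and \<open>N + 1\<close> extend oddly to functions of this period,
  twice the distance between the two boundary points.\<close>

definition period :: "nat \<Rightarrow> int" where
  "period N = 2 * (int N + 1)"

definition wave :: "nat \<Rightarrow> int \<Rightarrow> complex" where
  "wave N t = cis (pi * of_int t / real (N + 1))"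

lemma wave_add: "wave N (s + t) = wave N s * wave N t"
  by (simp add: wave_def cis_mult add_divide_distrib distrib_left)

lemma wave_0 [simp]: "wave N 0 = 1"
  by (simp add: wave_def)

lemma wave_nonzero [simp]: "wave N t \<noteq> 0"
  by (simp add: wave_def)

lemma cnj_wave: "cnj (wave N t) = wave N (- t)"
  by (simp add: wave_def cis_cnj)

lemma norm_wave [simp]: "cmod (wave N t) = 1"
  by (simp add: wave_def)

lemma wave_eq_1_iff: "wave N t = 1 \<longleftrightarrow> period N dvd t"
proof -
  have "wave N t = 1 \<longleftrightarrow> (\<exists>n::int. pi * of_int t / real (N + 1) = 2 * of_int n * pi)"
    unfolding wave_def cis_conv_exp exp_eq_1 by (auto simp: mult_ac)
  also have "\<dots> \<longleftrightarrow> (\<exists>n::int. pi * of_int t = pi * of_int (period N * n))"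
    by (intro ex_cong1) (auto simp: field_simps period_def)
  also have "\<dots> \<longleftrightarrow> (\<exists>n::int. (of_int t :: real) = of_int (period N * n))"
    by simp
  also have "\<dots> \<longleftrightarrow> (\<exists>n. t = period N * n)"
    by (simp only: of_int_eq_iff)
  finally show ?thesis by (simp add: dvd_def)
qed

lemma wave_eq_iff: "wave N s = wave N t \<longleftrightarrow> period N dvd s - t"
proof -
  have "wave N s = wave N (s - t) * wave N t"
    by (simp flip: wave_add)
  then show ?thesis by (simp flip: wave_eq_1_iff)
qed

lemma wave_eq_1_small:
  assumes "\<bar>t\<bar> < period N"
  shows "wave N t = 1 \<longleftrightarrow> t = 0"
  using assms unfolding wave_eq_1_iff by (metis abs_ge_self dual_order.strict_trans2 dvd_0_right dvd_imp_le_int not_le)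

text \<open>A geometric sum: multiplication by \<open>wave N s - 1\<close> makes it telescope, and
  the two ends agree because \<open>L\<close> is a multiple of the period. Later \<open>L\<close> is
  one period for the sines and two periods in \<open>fourier_Parseval\<close>.\<close>

lemma sum_wave:
  assumes "period N dvd int L"
  shows "(\<Sum>t\<in>{a..<a + int L}. wave N (t * s)) = (if period N dvd s then of_nat L else 0)"
proof (cases "period N dvd s")
  case True
  then have "wave N (t * s) = 1" for t
    by (simp add: wave_eq_1_iff)
  with True show ?thesis by simp
next
  case False
  let ?g = "\<lambda>t. wave N (t * s)"
  have "(wave N s - 1) * (\<Sum>t\<in>{a..<a + int L}. ?g t) = (\<Sum>t\<in>{a..<a + int L}. ?g (t + 1) - ?g t)"
    by (simp add: sum_distrib_left algebra_simps wave_add)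
  also have "\<dots> = ?g (a + int L) - ?g a"
    by (rule sum_telescope_int)
  also have "\<dots> = 0"
    using assms by (simp add: wave_eq_iff algebra_simps)
  finally show ?thesis using False by (simp add: wave_eq_1_iff)
qed

text \<open>Splitting the sine into two conjugate waves leaves complete sums at the frequencies
  \<open>x + y\<close> and \<open>x - y\<close>. The first lies strictly between 0 and the period
  and never contributes; the second contributes only when it is 0.\<close>

lemma sum_sin_wave:
  assumes "1 \<le> x" "x \<le> int N" "1 \<le> y" "y \<le> int N"
  shows "(\<Sum>t\<in>{0..<period N}. of_real (Im (wave N (t * y))) * wave N (t * x))
       = (if x = y then \<i> * of_nat (N + 1) else 0)"
proof -
  let ?T = "{0..<period N}"
  have T: "?T = {0..<0 + int (2 * (N + 1))}" by (simp add: period_def algebra_simps)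
  have L: "period N dvd int (2 * (N + 1))" by (simp add: period_def add.commute)
  have "of_real (Im w) = - \<i> / 2 * (w - cnj w)" for w :: complex
    by (simp add: complex_eq_iff)
  then have "of_real (Im (wave N (t * y))) * wave N (t * x) =
      - \<i> / 2 * (wave N (t * (x + y)) - wave N (t * (x - y)))" for t
    by (simp add: cnj_wave wave_add ring_distribs) (simp add: algebra_simps flip: wave_add)
  then have "(\<Sum>t\<in>?T. of_real (Im (wave N (t * y))) * wave N (t * x)) =
     - \<i> / 2 * ((\<Sum>t\<in>?T. wave N (t * (x + y))) - (\<Sum>t\<in>?T. wave N (t * (x - y))))"
    by (simp only: sum_distrib_left[symmetric] sum_subtractf)
  also have "\<not> period N dvd x + y"
    using assms by (auto dest: zdvd_imp_le simp: period_def)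
  then have "(\<Sum>t\<in>?T. wave N (t * (x + y))) = 0"
    unfolding T sum_wave[OF L] by simp
  also have "period N dvd x - y \<longleftrightarrow> x = y"
    using assms dvd_imp_le_int[of "x - y" "period N"] by (fastforce simp: period_def)
  then have "(\<Sum>t\<in>?T. wave N (t * (x - y))) = (if x = y then of_nat (2 * (N + 1)) else 0)"
    unfolding T sum_wave[OF L] by simp
  finally show ?thesis
    by (rule trans) (simp add: field_simps)
qed

lemma sum_sin_sin:
  assumes "1 \<le> x" "x \<le> int N" "1 \<le> y" "y \<le> int N"
  shows "(\<Sum>t\<in>{0..<period N}. Im (wave N (t * x)) * Im (wave N (t * y)))
       = (if x = y then real (N + 1) else 0)"
  using arg_cong[OF sum_sin_wave[OF assms], of Im] by (simp add: mult_ac split: if_splits)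

section \<open>Sine coefficients and plane-wave expansion on the box\<close>

text \<open>A full period makes all sums over frequencies complete. The modes are then redundant:
  negating one coordinate of \<open>k\<close> modulo the period only flips the sign of the sine
  wave.\<close>

definition freq_box :: "nat \<Rightarrow> (int ^ 'd::finite) set" where
  "freq_box N = vec_box (\<lambda>_. {0..<period N})"

definition plane_wave :: "nat \<Rightarrow> int ^ 'd::finite \<Rightarrow> int ^ 'd \<Rightarrow> complex" where
  "plane_wave N k x = (\<Prod>i\<in>UNIV. wave N (k $ i * x $ i))"

definition sine_wave :: "nat \<Rightarrow> int ^ 'd::finite \<Rightarrow> int ^ 'd \<Rightarrow> real" where
  "sine_wave N k x = (\<Prod>i\<in>UNIV. Im (wave N (k $ i * x $ i)))"

definition energy :: "nat \<Rightarrow> int ^ 'd::finite \<Rightarrow> real" where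
  "energy N k = (\<Sum>i\<in>UNIV. 2 * Re (wave N (k $ i)))"

definition sine_coeff :: "nat \<Rightarrow> (int ^ 'd::finite \<Rightarrow> complex) \<Rightarrow> int ^ 'd \<Rightarrow> complex" where
  "sine_coeff N f k = (\<Sum>x\<in>box_lattice N. of_real (sine_wave N k x) * f x)"

lemma finite_freq_box: "finite (freq_box N)"
  unfolding freq_box_def by (simp add: finite_vec_box)

lemma prod_if_eq_vec:
  fixes x y :: "'a ^ 'd::finite"
  shows "(\<Prod>i\<in>UNIV. if x $ i = y $ i then c else 0) =
         (if x = y then c ^ CARD('d) else (0 :: 'b::semidom))"
  by (auto simp: vec_eq_iff intro: prod_zero)

lemma sum_sine_wave_plane_wave:
  fixes x y :: "int ^ 'd::finite"
  assumes "x \<in> box_lattice N" "y \<in> box_lattice N"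
  shows "(\<Sum>k\<in>freq_box N. of_real (sine_wave N k y) * plane_wave N k x) =
         (if x = y then (\<i> * of_nat (N + 1)) ^ CARD('d) else 0)"
proof -
  have "(\<Sum>k\<in>freq_box N. of_real (sine_wave N k y) * plane_wave N k x) =
    (\<Prod>i\<in>UNIV. \<Sum>t\<in>{0..<period N}. of_real (Im (wave N (t * y $ i))) * wave N (t * x $ i))"
    unfolding freq_box_def sine_wave_def plane_wave_def
    by (subst sum_vec_box_prod[symmetric]) (simp_all add: prod.distrib)
  also have "\<dots> = (\<Prod>i\<in>UNIV. if x $ i = y $ i then \<i> * of_nat (N + 1) else 0)"
    using assms by (intro prod.cong refl sum_sin_wave) (auto simp: box_lattice_def)
  finally show ?thesis by (simp only: prod_if_eq_vec)
qed

lemma sum_sine_wave_sine_wave: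
  fixes x y :: "int ^ 'd::finite"
  assumes "x \<in> box_lattice N" "y \<in> box_lattice N"
  shows "(\<Sum>k\<in>freq_box N. sine_wave N k x * sine_wave N k y) =
         (if x = y then real (N + 1) ^ CARD('d) else 0)"
proof -
  have "(\<Sum>k\<in>freq_box N. sine_wave N k x * sine_wave N k y) =
    (\<Prod>i\<in>UNIV. \<Sum>t\<in>{0..<period N}. Im (wave N (t * x $ i)) * Im (wave N (t * y $ i)))"
    unfolding freq_box_def sine_wave_def
    by (subst sum_vec_box_prod[symmetric]) (simp_all add: prod.distrib)
  also have "\<dots> = (\<Prod>i\<in>UNIV. if x $ i = y $ i then real (N + 1) else 0)"
    using assms by (intro prod.cong refl sum_sin_sin) (auto simp: box_lattice_def)
  finally show ?thesis by (simp only: prod_if_eq_vec)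
qed

text \<open>Sine coefficients are paired with plane waves, not with sines, because translating a
  plane wave only multiplies it by a phase. The sum over \<open>k\<close> singles out
  \<open>y = x\<close> among the points of the box.\<close>

lemma sine_expansion:
  fixes f :: "int ^ 'd::finite \<Rightarrow> complex"
  assumes "x \<in> box_lattice N"
  shows "(\<Sum>k\<in>freq_box N. sine_coeff N f k * plane_wave N k x) =
         (\<i> * of_nat (N + 1)) ^ CARD('d) * f x"
proof -
  have "(\<Sum>k\<in>freq_box N. sine_coeff N f k * plane_wave N k x) =
    (\<Sum>y\<in>box_lattice N. f y * (\<Sum>k\<in>freq_box N. of_real (sine_wave N k y) * plane_wave N k x))"
    unfolding sine_coeff_def sum_distrib_left sum_distrib_right
    by (subst sum.swap) (simp add: mult_ac)
  also have "\<dots> = (\<Sum>y\<in>box_lattice N. if x = y then (\<i> * of_nat (N + 1)) ^ CARD('d) * f y else 0)"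
    using assms by (intro sum.cong refl) (subst sum_sine_wave_plane_wave, auto)
  finally show ?thesis using assms by (simp add: finite_box_lattice)
qed

text \<open>Parseval for the redundant system. An orthonormal basis thus has orthogonal coefficient
  vectors of common squared norm \<open>(N + 1) ^ CARD('d)\<close>, the form in which Bessel's
  inequality is applied.\<close>

lemma sine_coeff_inner:
  fixes f g :: "int ^ 'd::finite \<Rightarrow> complex"
  shows "(\<Sum>k\<in>freq_box N. cnj (sine_coeff N f k) * sine_coeff N g k) =
         of_nat (N + 1) ^ CARD('d) * box_inner N f g"
proof -
  have "(\<Sum>k\<in>freq_box N. cnj (sine_coeff N f k) * sine_coeff N g k) =
    (\<Sum>k\<in>freq_box N. \<Sum>x\<in>box_lattice N. \<Sum>y\<in>box_lattice N.
       cnj (f x) * g y * of_real (sine_wave N k x * sine_wave N k y))"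
    unfolding sine_coeff_def cnj_sum sum_product by (simp add: mult_ac)
  also have "\<dots> = (\<Sum>x\<in>box_lattice N. \<Sum>y\<in>box_lattice N. \<Sum>k\<in>freq_box N.
       cnj (f x) * g y * of_real (sine_wave N k x * sine_wave N k y))"
    by (rule trans[OF sum.swap], rule sum.cong[OF refl], rule sum.swap)
  also have "\<dots> = (\<Sum>x\<in>box_lattice N. \<Sum>y\<in>box_lattice N.
       cnj (f x) * g y * of_real (\<Sum>k\<in>freq_box N. sine_wave N k x * sine_wave N k y))"
    by (simp add: sum_distrib_left)
  also have "\<dots> = (\<Sum>x\<in>box_lattice N. \<Sum>y\<in>box_lattice N.
       if x = y then of_nat (N + 1) ^ CARD('d) * (cnj (f x) * g y) else 0)"
    by (intro sum.cong refl) (subst sum_sine_wave_sine_wave, auto)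
  finally show ?thesis
    by (simp add: finite_box_lattice box_inner_def sum_distrib_left)
qed


section \<open>Sine waves as eigenfunctions of the adjacency matrix\<close>

lemma l1_norm_eq_1_iff:
  fixes z :: "int ^ 'd::finite"
  shows "l1_norm z = 1 \<longleftrightarrow> (\<exists>i. \<exists>\<sigma>\<in>{1, -1}. z = axis i \<sigma>)"
proof
  assume z: "l1_norm z = 1"
  then obtain i where i: "z $ i \<noteq> 0"
    unfolding l1_norm_def by (metis abs_0 sum.neutral zero_neq_one)
  have split: "\<bar>z $ i\<bar> + (\<Sum>j\<in>UNIV - {i}. \<bar>z $ j\<bar>) = 1"
    using z unfolding l1_norm_def by (subst (asm) sum.remove[of _ i]) auto
  have nonneg: "0 \<le> (\<Sum>j\<in>UNIV - {i}. \<bar>z $ j\<bar>)"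
    by (intro sum_nonneg) auto
  with split i have *: "\<bar>z $ i\<bar> = 1" "(\<Sum>j\<in>UNIV - {i}. \<bar>z $ j\<bar>) = 0"
    by linarith+
  then have "z $ j = 0" if "j \<noteq> i" for j
    using that by (subst (asm) sum_nonneg_eq_0_iff) auto
  then have "z = axis i (z $ i)"
    by (auto simp: vec_eq_iff axis_def)
  moreover have "z $ i \<in> {1, -1}"
    using *(1) by auto
  ultimately show "\<exists>i. \<exists>\<sigma>\<in>{1, -1}. z = axis i \<sigma>"
    by blast
next
  have "l1_norm (axis i \<sigma>) = \<bar>\<sigma>\<bar>" for i :: 'd and \<sigma>
    unfolding l1_norm_def axis_def by (simp add: if_distrib cong: if_cong)
  then show "\<exists>i. \<exists>\<sigma>\<in>{1, -1}. z = axis i \<sigma> \<Longrightarrow> l1_norm z = 1"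
    by auto
qed

lemma sum_neighbours:
  fixes g :: "int ^ 'd::finite \<Rightarrow> 'a::comm_monoid_add"
  shows "(\<Sum>y | l1_norm (y - x) = 1. g y) = (\<Sum>i\<in>UNIV. g (x + axis i 1) + g (x + axis i (-1)))"
    and "finite {y. l1_norm (y - x) = 1}"
proof -
  let ?f = "\<lambda>(i, \<sigma>). x + axis i \<sigma>"
  have eq: "{y. l1_norm (y - x) = 1} = ?f ` (UNIV \<times> {1, -1})"
    by (force simp: l1_norm_eq_1_iff algebra_simps image_iff)
  have inj: "inj_on ?f (UNIV \<times> {1, -1})"
    by (auto simp: inj_on_def axis_eq_axis)
  have "(\<Sum>y | l1_norm (y - x) = 1. g y) = (\<Sum>i\<in>UNIV. \<Sum>\<sigma>\<in>{1, -1}. g (x + axis i \<sigma>))"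
    unfolding eq sum.reindex[OF inj] sum.cartesian_product' comp_def prod.case ..
  also have "\<dots> = (\<Sum>i\<in>UNIV. g (x + axis i 1) + g (x + axis i (-1)))"
    by (rule sum.cong[OF refl], subst sum.insert) auto
  finally show "(\<Sum>y | l1_norm (y - x) = 1. g y) = (\<Sum>i\<in>UNIV. g (x + axis i 1) + g (x + axis i (-1)))" .
  show "finite {y. l1_norm (y - x) = 1}"
    unfolding eq by auto
qed

text \<open>The factor at \<open>i\<close> is the sine of an integer multiple of pi. Because of
  these zeros the Dirichlet truncation does not affect sine waves.\<close>

lemma sine_wave_boundary:
  assumes "x $ i = 0 \<or> x $ i = int N + 1"
  shows "sine_wave N k x = 0"
proof -
  have "wave N (k $ i * (int N + 1)) = cis (pi * of_int (k $ i))"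
    by (simp add: wave_def add.commute)
  then have "Im (wave N (k $ i * (int N + 1))) = 0"
    by (simp only: cis.sel sin_npi_int)
  with assms have "Im (wave N (k $ i * x $ i)) = 0"
    by (elim disjE) (simp_all only: mult_zero_right wave_0 one_complex.sel)
  then show ?thesis
    unfolding sine_wave_def by (intro prod_zero) auto
qed

text \<open>This is sin (a + b) + sin (a - b) = 2 cos b sin a in coordinate \<open>i\<close>; the
  other factors are common to all terms.\<close>

lemma sine_wave_axis:
  "sine_wave N k (x + axis i 1) + sine_wave N k (x + axis i (-1)) = 2 * Re (wave N (k $ i)) * sine_wave N k x"
proof -
  let ?P = "\<Prod>j\<in>UNIV - {i}. Im (wave N (k $ j * x $ j))"
  have "sine_wave N k (x + axis i \<sigma>) = Im (wave N (k $ i * x $ i + k $ i * \<sigma>)) * ?P" for \<sigma>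
    unfolding sine_wave_def
    by (subst prod.remove[of _ i]) (auto simp: axis_def distrib_left intro!: prod.cong)
  from this[of 1] this[of "-1"]
  have "sine_wave N k (x + axis i 1) + sine_wave N k (x + axis i (-1)) =
      (Im (wave N (k $ i * x $ i + k $ i)) + Im (wave N (k $ i * x $ i + - (k $ i)))) * ?P"
    by (simp add: distrib_right)
  also have "\<dots> = 2 * Re (wave N (k $ i)) * (Im (wave N (k $ i * x $ i)) * ?P)"
    unfolding wave_add cnj_wave[symmetric] by (simp add: algebra_simps)
  also have "Im (wave N (k $ i * x $ i)) * ?P = sine_wave N k x"
    unfolding sine_wave_def by (subst (2) prod.remove[of _ i]) auto
  finally show ?thesis .
qed

text \<open>A neighbour outside the box has a coordinate equal to 0 or \<open>N + 1\<close>, where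
  the sine wave vanishes. The truncated sum is therefore the full lattice sum, and each coordinate
  contributes one term of the eigenvalue.\<close>

lemma sum_neighbours_sine_wave:
  assumes "x \<in> box_lattice N"
  shows "(\<Sum>y | y \<in> box_lattice N \<and> l1_norm (y - x) = 1. sine_wave N k y) = energy N k * sine_wave N k x"
proof -
  have outside: "sine_wave N k y = 0" if y: "l1_norm (y - x) = 1" "y \<notin> box_lattice N" for y
  proof -
    from y(1) obtain i \<sigma> where "\<sigma> \<in> {1, -1}" "y - x = axis i \<sigma>"
      by (auto simp: l1_norm_eq_1_iff)
    then have \<sigma>: "\<bar>\<sigma>\<bar> = 1" "y = x + axis i \<sigma>" by (auto simp: algebra_simps)
    have "y $ j = x $ j" if "j \<noteq> i" for j
      using that \<sigma> by (simp add: axis_def)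
    with y(2) assms have "\<not> (1 \<le> y $ i \<and> y $ i \<le> int N)"
      unfolding box_lattice_def mem_Collect_eq by metis
    moreover have "y $ i = x $ i + \<sigma>" "1 \<le> x $ i" "x $ i \<le> int N"
      using \<sigma> assms by (auto simp: box_lattice_def)
    ultimately have "y $ i = 0 \<or> y $ i = int N + 1"
      using \<sigma>(1) by linarith
    then show ?thesis by (rule sine_wave_boundary)
  qed
  have "(\<Sum>y | y \<in> box_lattice N \<and> l1_norm (y - x) = 1. sine_wave N k y) =
        (\<Sum>y | l1_norm (y - x) = 1. sine_wave N k y)"
    using outside by (intro sum.mono_neutral_left sum_neighbours) auto
  also have "\<dots> = energy N k * sine_wave N k x"
    unfolding sum_neighbours(1) sine_wave_axis energy_def sum_distrib_right ..
  finally show ?thesis .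
qed

lemma l1_norm_minus: "l1_norm (- x) = l1_norm x"
  by (simp add: l1_norm_def)

lemma l1_norm_minus_commute: "l1_norm (x - y) = l1_norm (y - x)"
  by (metis l1_norm_minus minus_diff_eq)

text \<open>The neighbour relation is symmetric, so the adjacency matrix can be moved from
  \<open>f\<close> onto the sine wave.\<close>

lemma sine_coeff_adjacency:
  "sine_coeff N (adjacency N f) k = of_real (energy N k) * sine_coeff N f k"
proof -
  let ?B = "box_lattice N" and ?s = "\<lambda>x. complex_of_real (sine_wave N k x)"
  have fin: "finite ?B" by (rule finite_box_lattice)
  have "sine_coeff N (adjacency N f) k =
    (\<Sum>x\<in>?B. \<Sum>y | y \<in> ?B \<and> l1_norm (y - x) = 1. ?s x * f y)"
    by (simp only: sine_coeff_def adjacency_def sum_distrib_left)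
  also have "\<dots> = (\<Sum>y\<in>?B. \<Sum>x | x \<in> ?B \<and> l1_norm (y - x) = 1. ?s x * f y)"
    by (rule sum.swap_restrict[OF fin fin])
  also have "\<dots> = (\<Sum>y\<in>?B. of_real (\<Sum>x | x \<in> ?B \<and> l1_norm (x - y) = 1. sine_wave N k x) * f y)"
    unfolding of_real_sum sum_distrib_right by (subst l1_norm_minus_commute) (rule refl)
  also have "\<dots> = of_real (energy N k) * sine_coeff N f k"
    unfolding sine_coeff_def sum_distrib_left
    by (intro sum.cong refl) (subst sum_neighbours_sine_wave, auto)
  finally show ?thesis .
qed

text \<open>Pairing the eigenvalue equation with a sine wave multiplies the same coefficient by its
  energy on one side and by \<open>\<mu>\<close> on the other, so a nonzero coefficient forces the
  energy to be \<open>\<mu>\<close>.\<close>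

lemma eigenfunction_sine_coeff:
  assumes "is_eigenfunction N f" "sine_coeff N f k \<noteq> 0" "sine_coeff N f l \<noteq> 0"
  shows "energy N k = energy N l"
proof -
  obtain \<mu> where \<mu>: "\<And>x. x \<in> box_lattice N \<Longrightarrow> adjacency N f x = \<mu> * f x"
    using assms(1) by (auto simp: is_eigenfunction_def)
  have *: "sine_coeff N (adjacency N f) k = \<mu> * sine_coeff N f k" for k
    unfolding sine_coeff_def sum_distrib_left by (intro sum.cong refl) (simp add: \<mu>)
  then have "\<mu> = of_real (energy N k)" if "sine_coeff N f k \<noteq> 0" for k
    using that *[of k] by (simp add: sine_coeff_adjacency)
  with assms show ?thesis by (metis of_real_eq_iff)
qed

section \<open>Bessel's inequality\<close>

text \<open>The vectors \<open>v j\<close> have common squared norm \<open>\<alpha>\<close>, so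
  \<open>w / \<alpha>\<close> with the \<open>w\<close> of the proof is the projection of
  \<open>G\<close> onto their span. The bound comes from expanding the squared norm of
  \<open>\<alpha> * G - w\<close>.\<close>

lemma Bessel_inequality:
  fixes v :: "'j \<Rightarrow> 'p \<Rightarrow> complex"
  assumes fin: "finite J" and \<alpha>: "\<alpha> > 0"
    and orth: "\<And>i j. i \<in> J \<Longrightarrow> j \<in> J \<Longrightarrow>
      (\<Sum>p\<in>P. cnj (v i p) * v j p) = (if i = j then of_real \<alpha> else 0)"
  shows "(\<Sum>j\<in>J. (cmod (\<Sum>p\<in>P. cnj (v j p) * G p))\<^sup>2) \<le> \<alpha> * (\<Sum>p\<in>P. (cmod (G p))\<^sup>2)"
proof -
  define a where "a j = (\<Sum>p\<in>P. cnj (v j p) * G p)" for j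
  define w where "w p = (\<Sum>j\<in>J. a j * v j p)" for p
  define A where "A = (\<Sum>j\<in>J. (cmod (a j))\<^sup>2)"
  have A: "complex_of_real A = (\<Sum>j\<in>J. cnj (a j) * a j)"
    unfolding A_def of_real_sum by (intro sum.cong refl) (metis complex_norm_square mult.commute of_real_power)
  have wG: "(\<Sum>p\<in>P. cnj (w p) * G p) = of_real A"
  proof -
    have "(\<Sum>p\<in>P. cnj (w p) * G p) = (\<Sum>j\<in>J. cnj (a j) * (\<Sum>p\<in>P. cnj (v j p) * G p))"
      unfolding w_def cnj_sum sum_distrib_left sum_distrib_right
      by (subst sum.swap) (simp add: mult_ac)
    then show ?thesis by (simp add: A a_def)
  qed
  have vw: "(\<Sum>p\<in>P. cnj (v i p) * w p) = of_real \<alpha> * a i" if "i \<in> J" for i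
  proof -
    have "(\<Sum>p\<in>P. cnj (v i p) * w p) = (\<Sum>j\<in>J. a j * (\<Sum>p\<in>P. cnj (v i p) * v j p))"
      unfolding w_def sum_distrib_left by (subst sum.swap) (simp add: mult_ac)
    also have "\<dots> = (\<Sum>j\<in>J. if i = j then of_real \<alpha> * a j else 0)"
      using that by (intro sum.cong refl) (simp add: orth)
    finally show ?thesis using fin that by simp
  qed
  have ww: "(\<Sum>p\<in>P. cnj (w p) * w p) = of_real (\<alpha> * A)"
  proof -
    have "(\<Sum>p\<in>P. cnj (w p) * w p) = (\<Sum>p\<in>P. \<Sum>j\<in>J. cnj (a j) * (cnj (v j p) * w p))"
      by (subst w_def) (simp add: sum_distrib_left sum_distrib_right mult_ac)
    also have "\<dots> = (\<Sum>j\<in>J. cnj (a j) * (\<Sum>p\<in>P. cnj (v j p) * w p))"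
      by (subst sum.swap) (simp add: sum_distrib_left)
    also have "\<dots> = of_real \<alpha> * (\<Sum>j\<in>J. cnj (a j) * a j)"
      unfolding sum_distrib_left[of "of_real \<alpha>"] by (intro sum.cong refl) (simp add: vw)
    finally show ?thesis by (simp add: A)
  qed
  have "0 \<le> (\<Sum>p\<in>P. (cmod (of_real \<alpha> * G p - w p))\<^sup>2)"
    by (intro sum_nonneg) auto
  also have "\<dots> = \<alpha>\<^sup>2 * (\<Sum>p\<in>P. (cmod (G p))\<^sup>2) - 2 * \<alpha> * Re (\<Sum>p\<in>P. cnj (w p) * G p)
                 + Re (\<Sum>p\<in>P. cnj (w p) * w p)"
    unfolding Re_sum sum_distrib_left sum_subtractf[symmetric] sum.distrib[symmetric]
    by (intro sum.cong refl) (simp only: cmod_power2, simp add: power2_eq_square algebra_simps)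
  also have "\<dots> = \<alpha> * (\<alpha> * (\<Sum>p\<in>P. (cmod (G p))\<^sup>2) - A)"
    unfolding wG ww by (simp add: power2_eq_square algebra_simps)
  finally have "A \<le> \<alpha> * (\<Sum>p\<in>P. (cmod (G p))\<^sup>2)"
    using \<alpha> by (simp add: zero_le_mult_iff)
  then show ?thesis by (simp add: A_def a_def)
qed

text \<open>Bessel's inequality for the rank-one matrices with entries \<open>u j l * cnj (u j k)\<close>.\<close>

lemma Bessel_quadratic_forms:
  fixes u :: "'j \<Rightarrow> 'p \<Rightarrow> complex"
  assumes fin: "finite J" and \<alpha>: "\<alpha> > 0"
    and orth: "\<And>i j. i \<in> J \<Longrightarrow> j \<in> J \<Longrightarrow>
      (\<Sum>p\<in>P. cnj (u i p) * u j p) = (if i = j then of_real \<alpha> else 0)"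
  shows "(\<Sum>j\<in>J. (cmod (\<Sum>k\<in>P. \<Sum>l\<in>P. cnj (u j k) * u j l * G k l))\<^sup>2)
      \<le> \<alpha>\<^sup>2 * (\<Sum>k\<in>P. \<Sum>l\<in>P. (cmod (G k l))\<^sup>2)"
proof -
  let ?v = "\<lambda>j (k, l). u j k * cnj (u j l)"
  have "(\<Sum>p\<in>P \<times> P. cnj (?v i p) * ?v j p) = (if i = j then of_real (\<alpha>\<^sup>2) else 0)"
    if "i \<in> J" "j \<in> J" for i j
  proof -
    have "(\<Sum>p\<in>P \<times> P. cnj (?v i p) * ?v j p) =
        (\<Sum>k\<in>P. cnj (u i k) * u j k) * cnj (\<Sum>k\<in>P. cnj (u i k) * u j k)"
      unfolding sum_product cnj_sum sum.cartesian_product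
      by (intro sum.cong refl) (auto simp: mult_ac)
    then show ?thesis using that by (simp add: orth power2_eq_square)
  qed
  from Bessel_inequality[OF fin _ this, where G = "\<lambda>(k, l). G k l"] \<alpha>
  have "(\<Sum>j\<in>J. (cmod (\<Sum>p\<in>P \<times> P. cnj (?v j p) * (case p of (k, l) \<Rightarrow> G k l)))\<^sup>2)
      \<le> \<alpha>\<^sup>2 * (\<Sum>p\<in>P \<times> P. (cmod (case p of (k, l) \<Rightarrow> G k l))\<^sup>2)"
    by simp
  then show ?thesis
    by (simp only: sum.cartesian_product' prod.case complex_cnj_mult complex_cnj_cnj)
qed


section \<open>Counting frequencies of equal energy\<close>

text \<open>For u = \<open>wave N t\<close> on the unit circle the condition reads 2 c = \<alpha> u
  + \<open>cnj \<alpha>\<close> / u. Since \<alpha> is nonzero, this is a genuine quadratic equation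
  for u, and u determines t within one period.\<close>

lemma card_wave_level_set:
  assumes s: "s \<noteq> 0" "\<bar>s\<bar> < period N"
  shows "card {t \<in> {0..<period N}. Re (wave N (t + s)) - Re (wave N t) = c} \<le> 2" (is "card ?A \<le> 2")
proof (cases "?A = {}")
  case False
  define \<alpha> where "\<alpha> = wave N s - 1"
  have \<alpha>: "\<alpha> \<noteq> 0"
    using s wave_eq_1_small[of s N] by (auto simp: \<alpha>_def)
  have quadratic: "2 * of_real c * wave N t = \<alpha> * (wave N t)\<^sup>2 + cnj \<alpha>" if "t \<in> ?A" for t
  proof -
    have "c = Re (\<alpha> * wave N t)"
      using that by (simp add: \<alpha>_def wave_add algebra_simps)
    then have "2 * of_real c = \<alpha> * wave N t + cnj (\<alpha> * wave N t)"
      by (simp add: complex_eq_iff)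
    moreover have "cnj (wave N t) * wave N t = 1"
      unfolding cnj_wave by (simp flip: wave_add)
    ultimately show ?thesis
      by (simp add: algebra_simps power2_eq_square)
  qed
  from False obtain t\<^sub>1 where t1: "t\<^sub>1 \<in> ?A" by blast
  \<comment> \<open>The two roots add up to \<open>2 * of_real c / \<alpha>\<close>: the difference
    of the equations at \<open>t\<close> and \<open>t\<^sub>1\<close> factors into the known root
    and the other one.\<close>
  have "wave N t \<in> {wave N t\<^sub>1, 2 * of_real c / \<alpha> - wave N t\<^sub>1}" if "t \<in> ?A" for t
  proof -
    have "(wave N t - wave N t\<^sub>1) * (\<alpha> * (wave N t + wave N t\<^sub>1) - 2 * of_real c) = 0"
      using quadratic[OF that] quadratic[OF t1] by (simp add: algebra_simps power2_eq_square)
    then have "wave N t = wave N t\<^sub>1 \<or> \<alpha> * (wave N t + wave N t\<^sub>1) = 2 * of_real c"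
      by (simp only: mult_eq_0_iff right_minus_eq)
    with \<alpha> show ?thesis by (auto simp: field_simps)
  qed
  then have "card (wave N ` ?A) \<le> card {wave N t\<^sub>1, 2 * of_real c / \<alpha> - wave N t\<^sub>1}"
    by (intro card_mono) auto
  also have "\<dots> \<le> 2"
    by (simp add: card_insert_if)
  also have "card (wave N ` ?A) = card ?A"
  proof (intro card_image inj_onI)
    fix t t' assume t: "t \<in> ?A" "t' \<in> ?A" "wave N t = wave N t'"
    then have "wave N (t - t') = 1"
      by (simp add: wave_eq_iff wave_eq_1_iff)
    moreover have "\<bar>t - t'\<bar> < period N" using t by auto
    ultimately show "t = t'"
      using wave_eq_1_small[of "t - t'" N] by (auto simp: period_def)
  qed
  finally show ?thesis .
next
  case True
  then show ?thesis by (simp only: card.empty)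
qed

text \<open>Freezing all coordinates except \<open>i\<close> turns the energy equation into the
  condition of \<open>card_wave_level_set\<close> with \<open>s = m $ i\<close>. Each of the
  \<open>(2 * (N + 1)) ^ (CARD('d) - 1)\<close> frozen choices leaves at most two solutions.\<close>

lemma card_equal_energy:
  fixes m :: "int ^ 'd::finite"
  assumes m: "m $ i \<noteq> 0" "\<bar>m $ i\<bar> < period N"
  shows "card {k \<in> freq_box N. energy N k = energy N (k + m)} \<le> 2 * (2 * (N + 1)) ^ (CARD('d) - 1)"
proof -
  let ?S = "{k \<in> freq_box N. energy N k = energy N (k + m)}"
  \<comment> \<open>Coordinate \<open>i\<close> is overwritten by 0 instead of dropped, which keeps
    the type; \<open>B\<close> contains all values of \<open>f\<close> on the frequency box.\<close>
  define f where "f k = (\<chi> j. if j = i then 0 else k $ j)" for k :: "int ^ 'd"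
  define B where "B = vec_box (\<lambda>j::'d. if j = i then {0} else {0..<period N})"
  have finB: "finite B" unfolding B_def by (intro finite_vec_box) auto
  have cardB: "card B = (2 * (N + 1)) ^ (CARD('d) - 1)"
  proof -
    have "card B = (\<Prod>j\<in>UNIV. if j = i then 1 else 2 * (N + 1))"
      unfolding B_def by (subst card_vec_box) (auto simp: period_def nat_add_distrib intro!: prod.cong)
    also have "\<dots> = (\<Prod>j\<in>UNIV - {i}. 2 * (N + 1))"
      by (subst prod.remove[of _ i]) (auto intro!: prod.cong)
    finally show ?thesis by (simp add: card_Diff_singleton)
  qed
  have fiber: "card {k \<in> ?S. f k = y} \<le> 2" for y
  proof -
    let ?w = "\<lambda>j. Re (wave N (y $ j + m $ j)) - Re (wave N (y $ j))"
    let ?A = "{t \<in> {0..<period N}. Re (wave N (t + m $ i)) - Re (wave N t) = - (\<Sum>j\<in>UNIV - {i}. ?w j)}"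
    have inj: "inj_on (\<lambda>k. k $ i) {k \<in> ?S. f k = y}"
    proof (rule inj_onI)
      fix k k' assume *: "k \<in> {k \<in> ?S. f k = y}" "k' \<in> {k \<in> ?S. f k = y}" "k $ i = k' $ i"
      then have "f k $ j = f k' $ j" for j by simp
      then have "(if j = i then 0 else k $ j) = (if j = i then 0 else k' $ j)" for j
        by (simp add: f_def)
      then have "k $ j = k' $ j" for j using *(3) by (cases "j = i") metis+
      then show "k = k'" by (simp add: vec_eq_iff)
    qed
    have "k $ i \<in> ?A" if k: "k \<in> ?S" "f k = y" for k
    proof -
      have yk: "y $ j = k $ j" if "j \<noteq> i" for j
        using that by (simp add: k(2)[symmetric] f_def)
      have "0 = (\<Sum>j\<in>UNIV. Re (wave N (k $ j + m $ j)) - Re (wave N (k $ j)))"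
        using k(1) by (simp add: energy_def sum_subtractf flip: sum_distrib_left)
      also have "\<dots> = Re (wave N (k $ i + m $ i)) - Re (wave N (k $ i)) +
          (\<Sum>j\<in>UNIV - {i}. Re (wave N (k $ j + m $ j)) - Re (wave N (k $ j)))"
        by (subst sum.remove[of _ i]) auto
      also have "(\<Sum>j\<in>UNIV - {i}. Re (wave N (k $ j + m $ j)) - Re (wave N (k $ j))) =
          (\<Sum>j\<in>UNIV - {i}. ?w j)"
        by (intro sum.cong refl) (simp add: yk)
      finally show ?thesis
        using k(1) by (simp add: freq_box_def vec_box_def)
    qed
    moreover have "finite ?A"
      by (rule finite_subset[of _ "{0..<period N}"]) auto
    ultimately have "card ((\<lambda>k. k $ i) ` {k \<in> ?S. f k = y}) \<le> card ?A"
      by (intro card_mono) blast+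
    also have "\<dots> \<le> 2"
      using m by (rule card_wave_level_set)
    finally show ?thesis by (simp only: card_image[OF inj])
  qed
  have "card ?S = card (\<Union>y\<in>B. {k \<in> ?S. f k = y})"
    by (rule arg_cong[of _ _ card]) (auto simp: B_def f_def vec_box_def freq_box_def)
  also have "\<dots> \<le> (\<Sum>y\<in>B. card {k \<in> ?S. f k = y})"
    by (rule card_UN_le[OF finB])
  also have "\<dots> \<le> (\<Sum>y\<in>B. 2)"
    by (intro sum_mono fiber)
  finally show ?thesis by (simp add: cardB mult.commute)
qed

section \<open>Fourier transform of the entries along one shift\<close>

lemma plane_wave_add_right: "plane_wave N k (x + y) = plane_wave N k x * plane_wave N k y"
  by (simp add: plane_wave_def distrib_left wave_add prod.distrib)

lemma plane_wave_diff_left: "plane_wave N (l - k) x = cnj (plane_wave N k x) * plane_wave N l x"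
  by (simp add: plane_wave_def cnj_wave left_diff_distrib prod.distrib[symmetric] wave_add[symmetric])

lemma plane_wave_zero_left [simp]: "plane_wave N 0 x = 1"
  by (simp add: plane_wave_def)

lemma norm_plane_wave [simp]: "cmod (plane_wave N k x) = 1"
  by (simp add: plane_wave_def prod_norm[symmetric])

definition fourier :: "nat \<Rightarrow> (int ^ 'd::finite) set \<Rightarrow> (int ^ 'd \<Rightarrow> complex) \<Rightarrow> int ^ 'd \<Rightarrow> complex" where
  "fourier N S b m = (\<Sum>x\<in>S. b x * plane_wave N m x)"

text \<open>The frequencies cover two periods per coordinate, enough for all differences
  \<open>l - k\<close>; hence the factor \<open>4 * (N + 1)\<close>. Coordinates of box points
  differ by less than a period, so distinct points give orthogonal functions of
  \<open>m\<close>.\<close>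

lemma fourier_Parseval:
  fixes S :: "(int ^ 'd::finite) set"
  assumes "S \<subseteq> box_lattice N"
  shows "(\<Sum>m\<in>vec_box (\<lambda>_. {- period N..<period N}). (cmod (fourier N S b m))\<^sup>2) =
    (4 * real (N + 1)) ^ CARD('d) * (\<Sum>x\<in>S. (cmod (b x))\<^sup>2)"
proof -
  let ?D = "vec_box (\<lambda>_::'d. {- period N..<period N})"
  have fin: "finite S" using assms finite_box_lattice by (rule finite_subset)
  have L: "period N dvd int (4 * (N + 1))" "{- period N..<period N} = {- period N..<- period N + int (4 * (N + 1))}"
    by (auto simp: period_def intro!: dvdI[of _ _ 2])
  have orth: "(\<Sum>m\<in>?D. plane_wave N m x * cnj (plane_wave N m y)) =
      (if x = y then of_nat (4 * (N + 1)) ^ CARD('d) else 0)" if "x \<in> S" "y \<in> S" for x y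
  proof -
    have xy: "x \<in> box_lattice N" "y \<in> box_lattice N" using that assms by auto
    have "(\<Sum>m\<in>?D. plane_wave N m x * cnj (plane_wave N m y)) =
        (\<Prod>i\<in>UNIV. \<Sum>t\<in>{- period N..<period N}. wave N (t * (x $ i - y $ i)))"
      unfolding plane_wave_def
      by (subst sum_vec_box_prod[symmetric])
        (simp_all add: cnj_wave right_diff_distrib prod.distrib[symmetric] wave_add[symmetric])
    also have "\<dots> = (\<Prod>i\<in>UNIV. if x $ i = y $ i then of_nat (4 * (N + 1)) else 0)"
    proof (intro prod.cong refl)
      fix i
      have "\<bar>x $ i - y $ i\<bar> < period N"
        using xy by (auto simp: box_lattice_def period_def dest!: spec[of _ i])
      then have "period N dvd x $ i - y $ i \<longleftrightarrow> x $ i = y $ i"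
        using wave_eq_1_small[of "x $ i - y $ i" N] by (auto simp: period_def wave_eq_1_iff)
      then show "(\<Sum>t\<in>{- period N..<period N}. wave N (t * (x $ i - y $ i))) =
          (if x $ i = y $ i then of_nat (4 * (N + 1)) else 0)"
        unfolding L(2) sum_wave[OF L(1)] by simp
    qed
    finally show ?thesis by (simp only: prod_if_eq_vec)
  qed
  have "complex_of_real (\<Sum>m\<in>?D. (cmod (fourier N S b m))\<^sup>2) =
      (\<Sum>m\<in>?D. \<Sum>x\<in>S. \<Sum>y\<in>S. b x * cnj (b y) * (plane_wave N m x * cnj (plane_wave N m y)))"
    by (simp only: of_real_sum complex_norm_square fourier_def cnj_sum sum_product complex_cnj_mult mult_ac)
  also have "\<dots> = (\<Sum>x\<in>S. \<Sum>y\<in>S. \<Sum>m\<in>?D. b x * cnj (b y) * (plane_wave N m x * cnj (plane_wave N m y)))"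
    by (rule trans[OF sum.swap], rule sum.cong[OF refl], rule sum.swap)
  also have "\<dots> = (\<Sum>x\<in>S. \<Sum>y\<in>S. if x = y then of_nat (4 * (N + 1)) ^ CARD('d) * (b x * cnj (b y)) else 0)"
    unfolding sum_distrib_left[symmetric] by (intro sum.cong refl) (simp add: orth)
  also have "\<dots> = complex_of_real ((4 * real (N + 1)) ^ CARD('d) * (\<Sum>x\<in>S. (cmod (b x))\<^sup>2))"
    using fin by (simp add: sum_distrib_left complex_norm_square[symmetric])
  finally show ?thesis by (simp only: of_real_eq_iff)
qed

text \<open>Sorted by \<open>m = l - k\<close>, the double sum weights each squared Fourier
  coefficient by the number of \<open>k\<close> having the same energy as \<open>k + m\<close>. For
  nonzero \<open>m\<close> this number is of lower order than the size of the frequency box.\<close>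

lemma sum_fourier_equal_energy:
  fixes S :: "(int ^ 'd::finite) set"
  assumes S: "S \<subseteq> box_lattice N" and mean: "(\<Sum>x\<in>S. b x) = 0"
  shows "(\<Sum>k\<in>freq_box N. \<Sum>l\<in>freq_box N.
            if energy N k = energy N l then (cmod (fourier N S b (l - k)))\<^sup>2 else 0)
    \<le> 2 * (2 * real (N + 1)) ^ (CARD('d) - 1) * (4 * real (N + 1)) ^ CARD('d) * (\<Sum>x\<in>S. (cmod (b x))\<^sup>2)"
proof -
  let ?T = "freq_box N :: (int ^ 'd) set"
  \<comment> \<open>Strict at both ends, since \<open>card_equal_energy\<close> needs a nonzero
    coordinate of absolute value below the period.\<close>
  let ?D = "vec_box (\<lambda>_::'d. {- period N<..<period N})"
  let ?b = "\<lambda>m. (cmod (fourier N S b m))\<^sup>2"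
  let ?c = "2 * (2 * real (N + 1)) ^ (CARD('d) - 1)"
  have fin: "finite ?D" "finite ?T"
    by (auto intro: finite_vec_box simp: finite_freq_box)
  have "(\<Sum>l\<in>?T. if energy N k = energy N l then ?b (l - k) else 0)
      \<le> (\<Sum>m\<in>?D. if energy N k = energy N (k + m) then ?b m else 0)" if "k \<in> ?T" for k
  proof -
    have "(\<Sum>l\<in>?T. if energy N k = energy N l then ?b (l - k) else 0) =
        (\<Sum>m\<in>(\<lambda>l. l - k) ` ?T. if energy N k = energy N (k + m) then ?b m else 0)"
      by (subst sum.reindex) (auto simp: inj_on_def)
    also have "\<dots> \<le> (\<Sum>m\<in>?D. if energy N k = energy N (k + m) then ?b m else 0)"
    proof (rule sum_mono2[OF fin(1)])
      have "l - k \<in> ?D" if "l \<in> ?T" for l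
      proof -
        have "0 \<le> k $ i \<and> k $ i < period N" "0 \<le> l $ i \<and> l $ i < period N" for i
          using that \<open>k \<in> ?T\<close> by (auto simp: freq_box_def vec_box_def)
        then have "- period N < l $ i - k $ i \<and> l $ i - k $ i < period N" for i
          by (smt (verit))
        then show ?thesis by (simp add: vec_box_def)
      qed
      then show "(\<lambda>l. l - k) ` ?T \<subseteq> ?D" by blast
    qed auto
    finally show ?thesis .
  qed
  then have "(\<Sum>k\<in>?T. \<Sum>l\<in>?T. if energy N k = energy N l then ?b (l - k) else 0)
      \<le> (\<Sum>k\<in>?T. \<Sum>m\<in>?D. if energy N k = energy N (k + m) then ?b m else 0)"
    by (rule sum_mono)
  also have "\<dots> = (\<Sum>m\<in>?D. \<Sum>k\<in>?T. if energy N k = energy N (k + m) then ?b m else 0)"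
    by (rule sum.swap)
  also have "\<dots> = (\<Sum>m\<in>?D. real (card {k \<in> ?T. energy N k = energy N (k + m)}) * ?b m)"
    by (simp add: fin sum.inter_filter[symmetric])
  also have "\<dots> \<le> (\<Sum>m\<in>?D. ?c * ?b m)"
  proof (rule sum_mono)
    fix m assume m: "m \<in> ?D"
    show "real (card {k \<in> ?T. energy N k = energy N (k + m)}) * ?b m \<le> ?c * ?b m"
    proof (cases "m = 0")
      \<comment> \<open>At \<open>m = 0\<close> every \<open>k\<close> is counted, but the Fourier
        coefficient is the sum of \<open>b\<close>, which is zero.\<close>
      case True
      then show ?thesis by (simp add: fourier_def mean)
    next
      case False
      then obtain i where "m $ i \<noteq> 0" by (auto simp: vec_eq_iff)
      moreover have "\<bar>m $ i\<bar> < period N"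
        using m by (auto simp: vec_box_def abs_less_iff dest!: spec[of _ i])
      ultimately have "real (card {k \<in> ?T. energy N k = energy N (k + m)}) \<le> real (2 * (2 * (N + 1)) ^ (CARD('d) - 1))"
        by (intro of_nat_mono card_equal_energy)
      then show ?thesis by (intro mult_right_mono) auto
    qed
  qed
  \<comment> \<open>Parseval uses the half-open range; enlarging the strict one only adds
    nonnegative terms.\<close>
  also have "\<dots> \<le> ?c * (\<Sum>m\<in>vec_box (\<lambda>_. {- period N..<period N}). ?b m)"
    unfolding sum_distrib_left[symmetric]
    by (intro mult_left_mono sum_mono2 finite_vec_box) (auto simp: vec_box_def less_imp_le)
  finally show ?thesis
    unfolding fourier_Parseval[OF S] by (simp add: mult.assoc)
qed

section \<open>Variance for a single shift\<close>

text \<open>Both \<open>x\<close> and \<open>x + z\<close> lie in the box, so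
  \<open>sine_expansion\<close> applies at each. The shift contributes only the phase
  \<open>plane_wave N l z\<close>, and the sum over \<open>x\<close> becomes a Fourier
  coefficient.\<close>

lemma shift_dom_sum_eq_quadratic_form:
  fixes f b :: "int ^ 'd::finite \<Rightarrow> complex"
  shows "of_nat (N + 1) ^ (2 * CARD('d)) * (\<Sum>x\<in>shift_dom N z. b x * (cnj (f x) * f (x + z))) =
    (\<Sum>k\<in>freq_box N. \<Sum>l\<in>freq_box N.
       cnj (sine_coeff N f k) * sine_coeff N f l *
         (plane_wave N l z * fourier N (shift_dom N z) b (l - k)))"
proof -
  let ?c = "sine_coeff N f"
  let ?T = "freq_box N :: (int ^ 'd) set" and ?L = "shift_dom N z"
  \<comment> \<open>The constant of \<open>sine_expansion\<close>, which enters once conjugated and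
    once plain.\<close>
  define \<kappa> where "\<kappa> = (\<i> * of_nat (N + 1)) ^ CARD('d)"
  have \<kappa>: "cnj \<kappa> * \<kappa> = of_nat (N + 1) ^ (2 * CARD('d))"
  proof -
    have "cmod \<kappa> = real (N + 1) ^ CARD('d)"
      unfolding \<kappa>_def by (simp only: norm_power norm_mult norm_ii norm_of_nat mult_1)
    then have "cnj \<kappa> * \<kappa> = of_real ((real (N + 1) ^ CARD('d))\<^sup>2)"
      by (metis complex_norm_square mult.commute)
    then show ?thesis
      by (simp only: of_real_power of_real_of_nat_eq power_mult[symmetric] mult.commute)
  qed
  have "of_nat (N + 1) ^ (2 * CARD('d)) * (\<Sum>x\<in>?L. b x * (cnj (f x) * f (x + z))) =
      (\<Sum>x\<in>?L. b x * (cnj (\<kappa> * f x) * (\<kappa> * f (x + z))))"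
    unfolding sum_distrib_left \<kappa>[symmetric] by (simp add: mult_ac)
  also have "\<dots> = (\<Sum>x\<in>?L. b x * (cnj (\<Sum>k\<in>?T. ?c k * plane_wave N k x) *
      (\<Sum>l\<in>?T. ?c l * plane_wave N l (x + z))))"
    unfolding \<kappa>_def
    by (intro sum.cong refl) (simp only: shift_dom_def mem_Collect_eq sine_expansion)
  also have "\<dots> = (\<Sum>x\<in>?L. \<Sum>k\<in>?T. \<Sum>l\<in>?T.
      cnj (?c k) * ?c l * (plane_wave N l z * (b x * plane_wave N (l - k) x)))"
    unfolding cnj_sum sum_product unfolding sum_distrib_left plane_wave_add_right plane_wave_diff_left
    by (simp add: mult_ac)
  also have "\<dots> = (\<Sum>k\<in>?T. \<Sum>l\<in>?T. \<Sum>x\<in>?L.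
      cnj (?c k) * ?c l * (plane_wave N l z * (b x * plane_wave N (l - k) x)))"
    by (rule trans[OF sum.swap], rule sum.cong[OF refl], rule sum.swap)
  finally show ?thesis
    by (simp only: fourier_def sum_distrib_left)
qed

text \<open>Bookkeeping for \<open>n = N + 1\<close>: Bessel contributes
  \<open>(n ^ d)\<^sup>2\<close>, the count \<open>2 * (2 * n) ^ (d - 1)\<close> and Parseval
  \<open>(4 * n) ^ d\<close>. The power of \<open>n\<close> missing from the count is the gain
  \<open>1 / n\<close>.\<close>

lemma variance_constant:
  fixes n s :: real
  assumes "n \<noteq> 0" "d > 0"
  shows "(n ^ d)\<^sup>2 * (2 * (2 * n) ^ (d - 1) * (4 * n) ^ d * s) = (n ^ (2 * d))\<^sup>2 * (8 ^ d / n * s)"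
proof -
  obtain e where d: "d = Suc e" using \<open>d > 0\<close> by (cases d) auto
  have e: "(8 :: real) ^ e = 2 ^ e * 4 ^ e" by (simp flip: power_mult_distrib)
  have n: "n ^ (2 * d) = n * n * (n ^ e * n ^ e)"
    by (simp add: d power_add mult_2)
  show ?thesis
    unfolding n using \<open>n \<noteq> 0\<close> by (simp add: d e power_mult_distrib power2_eq_square)
qed

lemma eigenfunction_variance_bound:
  fixes \<psi> :: "'j \<Rightarrow> int ^ 'd::finite \<Rightarrow> complex"
  assumes J: "finite J"
    and orth: "\<And>i j. i \<in> J \<Longrightarrow> j \<in> J \<Longrightarrow> box_inner N (\<psi> i) (\<psi> j) = (if i = j then 1 else 0)"
    and eigen: "\<And>j. j \<in> J \<Longrightarrow> is_eigenfunction N (\<psi> j)"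
    and mean: "(\<Sum>x\<in>shift_dom N z. b x) = 0"
  shows "(\<Sum>j\<in>J. (cmod (\<Sum>x\<in>shift_dom N z. b x * (cnj (\<psi> j x) * \<psi> j (x + z))))\<^sup>2)
    \<le> 8 ^ CARD('d) / real (N + 1) * (\<Sum>x\<in>shift_dom N z. (cmod (b x))\<^sup>2)"
proof -
  let ?T = "freq_box N :: (int ^ 'd) set" and ?L = "shift_dom N z" and ?n = "real (N + 1)"
  define F where "F j = (\<Sum>x\<in>?L. b x * (cnj (\<psi> j x) * \<psi> j (x + z)))" for j
  define c where "c j = sine_coeff N (\<psi> j)" for j
  \<comment> \<open>Discarding unequal energies costs nothing, since there \<open>c j k\<close> and
    \<open>c j l\<close> are never both nonzero. The cut-off does not involve the eigenvalue of
    \<open>\<psi> j\<close>, so one matrix serves all \<open>j\<close>, as Bessel's inequality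
    requires.\<close>
  define G where "G k l = (if energy N k = energy N l then plane_wave N l z * fourier N ?L b (l - k) else 0)"
    for k l
  have F: "of_nat (N + 1) ^ (2 * CARD('d)) * F j = (\<Sum>k\<in>?T. \<Sum>l\<in>?T. cnj (c j k) * c j l * G k l)"
    if "j \<in> J" for j
    unfolding F_def shift_dom_sum_eq_quadratic_form c_def[symmetric]
    using eigenfunction_sine_coeff[OF eigen[OF that]]
    by (intro sum.cong refl) (auto simp: G_def c_def)
  have "(?n ^ (2 * CARD('d)))\<^sup>2 * (\<Sum>j\<in>J. (cmod (F j))\<^sup>2) =
      (\<Sum>j\<in>J. (cmod (of_nat (N + 1) ^ (2 * CARD('d)) * F j))\<^sup>2)"
    unfolding sum_distrib_left norm_mult norm_power norm_of_nat by (simp only: power_mult_distrib)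
  also have "\<dots> = (\<Sum>j\<in>J. (cmod (\<Sum>k\<in>?T. \<Sum>l\<in>?T. cnj (c j k) * c j l * G k l))\<^sup>2)"
    by (intro sum.cong refl) (simp only: F)
  also have "\<dots> \<le> (?n ^ CARD('d))\<^sup>2 * (\<Sum>k\<in>?T. \<Sum>l\<in>?T. (cmod (G k l))\<^sup>2)"
    by (rule Bessel_quadratic_forms) (use J orth in \<open>simp_all add: c_def sine_coeff_inner\<close>)
  also have "(\<Sum>k\<in>?T. \<Sum>l\<in>?T. (cmod (G k l))\<^sup>2) =
      (\<Sum>k\<in>?T. \<Sum>l\<in>?T. if energy N k = energy N l then (cmod (fourier N ?L b (l - k)))\<^sup>2 else 0)"
    by (intro sum.cong refl) (simp add: G_def norm_mult)
  also have "(?n ^ CARD('d))\<^sup>2 * \<dots> \<le> (?n ^ CARD('d))\<^sup>2 *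
      (2 * (2 * ?n) ^ (CARD('d) - 1) * (4 * ?n) ^ CARD('d) * (\<Sum>x\<in>?L. (cmod (b x))\<^sup>2))"
    by (intro mult_left_mono sum_fourier_equal_energy mean) (auto simp: shift_dom_def)
  also have "\<dots> = (?n ^ (2 * CARD('d)))\<^sup>2 * (8 ^ CARD('d) / ?n * (\<Sum>x\<in>?L. (cmod (b x))\<^sup>2))"
    by (rule variance_constant) auto
  finally show ?thesis
    unfolding F_def by (subst (asm) mult_le_cancel_left_pos) auto
qed


section \<open>Splitting observables by shifts\<close>

text \<open>Pairs of box points are grouped by their difference \<open>z\<close>. The correlator is
  the same expression with each entry replaced by the mean along its shift, so entries of mean zero
  remain.\<close>

lemma obs_apply_minus_correlator:
  fixes K :: "int ^ 'd::finite \<Rightarrow> int ^ 'd \<Rightarrow> complex"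
  shows "box_inner N f (obs_apply N K f) - correlator N K f =
    (\<Sum>z | shift_dom N z \<noteq> {}. \<Sum>x\<in>shift_dom N z.
       (K x (x + z) - (\<Sum>y\<in>shift_dom N z. K y (y + z)) / of_nat (card (shift_dom N z)))
         * (cnj (f x) * f (x + z)))"
proof -
  let ?B = "box_lattice N :: (int ^ 'd) set" and ?Z = "{z :: int ^ 'd. shift_dom N z \<noteq> {}}"
  have inner_shift: "box_inner N f (shift N z f) = (\<Sum>x\<in>shift_dom N z. cnj (f x) * f (x + z))" for z
    unfolding box_inner_def shift_def shift_dom_def
    by (subst sum.inter_filter[OF finite_box_lattice]) (intro sum.cong refl, simp)
  have corr: "correlator N K f = (\<Sum>z\<in>?Z. \<Sum>x\<in>shift_dom N z.
      (\<Sum>y\<in>shift_dom N z. K y (y + z)) / of_nat (card (shift_dom N z)) * (cnj (f x) * f (x + z)))"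
    unfolding correlator_def inner_shift sum_distrib_left[symmetric]
    by (simp add: sum_divide_distrib sum_distrib_right)
  have "box_inner N f (obs_apply N K f) = (\<Sum>x\<in>?B. \<Sum>y\<in>?B. K x y * (cnj (f x) * f y))"
    unfolding box_inner_def obs_apply_def sum_distrib_left by (simp add: mult_ac)
  also have "\<dots> = (\<Sum>(x, y)\<in>?B \<times> ?B. K x y * (cnj (f x) * f y))"
    by (rule sum.cartesian_product)
  also have "\<dots> = (\<Sum>(z, x)\<in>Sigma ?Z (shift_dom N). K x (x + z) * (cnj (f x) * f (x + z)))"
    by (rule sum.reindex_bij_witness[of _ "\<lambda>(z, x). (x, x + z)" "\<lambda>(x, y). (y - x, x)"])
      (auto simp: shift_dom_def)
  also have "\<dots> = (\<Sum>z\<in>?Z. \<Sum>x\<in>shift_dom N z. K x (x + z) * (cnj (f x) * f (x + z)))"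
    by (rule sum.Sigma[symmetric]) (auto simp: finite_shifts finite_shift_dom)
  finally show ?thesis
    unfolding corr by (simp add: sum_subtractf left_diff_distrib)
qed

lemma abs_le_l1_norm: "\<bar>z $ i\<bar> \<le> l1_norm z"
  unfolding l1_norm_def by (rule member_le_sum) auto

lemma finite_l1_ball: "finite {z :: int ^ 'd::finite. l1_norm z \<le> r}"
proof (rule finite_subset)
  have "- r \<le> z $ i \<and> z $ i \<le> r" if "l1_norm z \<le> r" for z :: "int ^ 'd" and i
    using abs_le_l1_norm[of z i] that by linarith
  then show "{z :: int ^ 'd. l1_norm z \<le> r} \<subseteq> vec_box (\<lambda>_. {- r..r})"
    by (auto simp: vec_box_def)
qed (simp add: finite_vec_box)

lemma shift_dom_zero: "shift_dom N 0 = box_lattice N"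
  by (auto simp: shift_dom_def)

text \<open>Only \<open>z = 0\<close> meets the diagonal; there \<open>shift N 0 f\<close> agrees
  with \<open>f\<close> on the box and the inner product is 1.\<close>

lemma correlator_diagonal:
  fixes K :: "int ^ 'd::finite \<Rightarrow> int ^ 'd \<Rightarrow> complex"
  assumes N: "N \<ge> 1" and unit: "box_inner N f f = 1"
    and diag: "\<And>x y. x \<in> box_lattice N \<Longrightarrow> y \<in> box_lattice N \<Longrightarrow> x \<noteq> y \<Longrightarrow> K x y = 0"
  shows "correlator N K f =
    1 / of_nat (card (box_lattice N :: (int ^ 'd) set)) * (\<Sum>x\<in>box_lattice N. K x x)"
proof -
  let ?B = "box_lattice N :: (int ^ 'd) set"
  \<comment> \<open>Nonemptiness of the box puts \<open>z = 0\<close> into the range of the outer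
    sum.\<close>
  have "(\<chi> i. 1) \<in> ?B" using N by (simp add: box_lattice_def)
  then have B: "?B \<noteq> {}" by blast
  have "correlator N K f = (\<Sum>z\<in>{0}. \<Sum>x\<in>shift_dom N z.
      1 / of_nat (card (shift_dom N z)) * K x (x + z) * box_inner N f (shift N z f))"
    unfolding correlator_def
  proof (rule sum.mono_neutral_right)
    show "\<forall>z\<in>{z. shift_dom N z \<noteq> {}} - {0}. (\<Sum>x\<in>shift_dom N z.
        1 / of_nat (card (shift_dom N z)) * K x (x + z) * box_inner N f (shift N z f)) = 0"
      by (auto simp: shift_dom_def diag intro!: sum.neutral)
  qed (use B in \<open>auto simp: finite_shifts shift_dom_zero\<close>)
  also have "box_inner N f (shift N 0 f) = 1"
    using unit by (simp add: box_inner_def shift_def)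
  then have "(\<Sum>z\<in>{0}. \<Sum>x\<in>shift_dom N z.
      1 / of_nat (card (shift_dom N z)) * K x (x + z) * box_inner N f (shift N z f)) =
      1 / of_nat (card ?B) * (\<Sum>x\<in>?B. K x x)"
    by (simp add: shift_dom_zero sum_distrib_left del: sum_divide_distrib)
  finally show ?thesis .
qed

lemma sum_norm_squared_le:
  fixes g :: "'a \<Rightarrow> complex"
  shows "(cmod (\<Sum>x\<in>A. g x))\<^sup>2 \<le> real (card A) * (\<Sum>x\<in>A. (cmod (g x))\<^sup>2)"
proof -
  have "(cmod (\<Sum>x\<in>A. g x))\<^sup>2 \<le> (\<Sum>x\<in>A. cmod (g x))\<^sup>2"
    by (intro power_mono norm_sum) auto
  also have "\<dots> = (\<Sum>x\<in>A. 1 * cmod (g x))\<^sup>2" by simp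
  also have "\<dots> \<le> (\<Sum>x\<in>A. 1\<^sup>2) * (\<Sum>x\<in>A. (cmod (g x))\<^sup>2)"
    by (rule Cauchy_Schwarz_ineq_sum)
  finally show ?thesis by simp
qed

section \<open>The quantum variance and its limit\<close>

text \<open>The number of shifts of norm at most \<open>r\<close> enters squared: once through
  Cauchy-Schwarz over the shifts, once through summing the single-shift bounds. The 4 arises because
  an entry minus its mean has modulus at most 2.\<close>

lemma quantum_variance_bound:
  fixes \<psi> :: "'j \<Rightarrow> int ^ 'd::finite \<Rightarrow> complex" and K :: "int ^ 'd \<Rightarrow> int ^ 'd \<Rightarrow> complex"
  assumes J: "finite J"
    and orth: "\<And>i j. i \<in> J \<Longrightarrow> j \<in> J \<Longrightarrow> box_inner N (\<psi> i) (\<psi> j) = (if i = j then 1 else 0)"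
    and eigen: "\<And>j. j \<in> J \<Longrightarrow> is_eigenfunction N (\<psi> j)"
    and range: "\<And>x y. x \<in> box_lattice N \<Longrightarrow> y \<in> box_lattice N \<Longrightarrow> l1_norm (x - y) > r \<Longrightarrow> K x y = 0"
    and bound: "\<And>x y. x \<in> box_lattice N \<Longrightarrow> y \<in> box_lattice N \<Longrightarrow> cmod (K x y) \<le> 1"
  shows "(\<Sum>j\<in>J. (cmod (box_inner N (\<psi> j) (obs_apply N K (\<psi> j)) - correlator N K (\<psi> j)))\<^sup>2)
    \<le> 4 * 8 ^ CARD('d) * real (card {z :: int ^ 'd. l1_norm z \<le> r}) ^ 2 * real N ^ CARD('d) / real (N + 1)"
proof -
  let ?L = "shift_dom N :: int ^ 'd \<Rightarrow> _" and ?C = "8 ^ CARD('d) / real (N + 1)"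
  let ?M = "card {z :: int ^ 'd. l1_norm z \<le> r}"
  define Z where "Z = {z. ?L z \<noteq> {}} \<inter> {z. l1_norm z \<le> r}"
  define b where "b z x = K x (x + z) - (\<Sum>y\<in>?L z. K y (y + z)) / of_nat (card (?L z))" for z x
  define F where "F j z = (\<Sum>x\<in>?L z. b z x * (cnj (\<psi> j x) * \<psi> j (x + z)))" for j z
  have finZ: "finite Z" and cardZ: "card Z \<le> ?M"
    unfolding Z_def by (auto intro: card_mono finite_l1_ball)
  \<comment> \<open>Beyond the range the entries vanish, and so does their mean. The sum over shifts
    reduces to \<open>Z\<close>, whose size is bounded independently of \<open>N\<close>.\<close>
  have b_far: "b z x = 0" if "x \<in> ?L z" "l1_norm z > r" for x z
  proof -
    have "K y (y + z) = 0" if "y \<in> ?L z" for y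
      using that \<open>l1_norm z > r\<close> by (intro range) (auto simp: shift_dom_def l1_norm_minus)
    with that show ?thesis by (simp add: b_def)
  qed
  have b_mean: "(\<Sum>x\<in>?L z. b z x) = 0" if "z \<in> Z" for z
    using that finite_shift_dom[of N z] by (simp add: b_def Z_def sum_subtractf)
  have b_bound: "cmod (b z x) \<le> 2" if "x \<in> ?L z" for z x
  proof -
    have "cmod (\<Sum>y\<in>?L z. K y (y + z)) \<le> (\<Sum>y\<in>?L z. 1)"
      by (intro sum_norm_le bound) (auto simp: shift_dom_def)
    then have "cmod ((\<Sum>y\<in>?L z. K y (y + z)) / of_nat (card (?L z))) \<le> 1"
      by (auto simp: norm_divide divide_le_eq_1)
    moreover have "cmod (K x (x + z)) \<le> 1"
      using that by (intro bound) (auto simp: shift_dom_def)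
    ultimately show ?thesis
      unfolding b_def by (intro order_trans[OF norm_triangle_ineq4]) simp
  qed
  have b_norm: "(\<Sum>x\<in>?L z. (cmod (b z x))\<^sup>2) \<le> 4 * real N ^ CARD('d)" for z
  proof -
    have "(\<Sum>x\<in>?L z. (cmod (b z x))\<^sup>2) \<le> (\<Sum>x\<in>?L z. 2\<^sup>2)"
      by (intro sum_mono power_mono b_bound) auto
    also have "\<dots> \<le> 4 * real (card (box_lattice N :: (int ^ 'd) set))"
      by (simp, intro card_mono finite_box_lattice) (auto simp: shift_dom_def)
    finally show ?thesis by (simp add: card_box_lattice)
  qed
  have "box_inner N (\<psi> j) (obs_apply N K (\<psi> j)) - correlator N K (\<psi> j) = (\<Sum>z\<in>Z. F j z)" for j
    unfolding obs_apply_minus_correlator b_def[symmetric] F_def[symmetric]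
    by (rule sum.mono_neutral_right)
      (auto simp: finite_shifts Z_def F_def b_far not_le intro!: sum.neutral)
  then have "(\<Sum>j\<in>J. (cmod (box_inner N (\<psi> j) (obs_apply N K (\<psi> j)) - correlator N K (\<psi> j)))\<^sup>2)
      \<le> (\<Sum>j\<in>J. real (card Z) * (\<Sum>z\<in>Z. (cmod (F j z))\<^sup>2))"
    by (intro sum_mono) (simp add: sum_norm_squared_le)
  also have "\<dots> = real (card Z) * (\<Sum>z\<in>Z. \<Sum>j\<in>J. (cmod (F j z))\<^sup>2)"
    unfolding sum_distrib_left[symmetric] by (subst sum.swap) (rule refl)
  also have "\<dots> \<le> real (card Z) * (\<Sum>z\<in>Z. ?C * (4 * real N ^ CARD('d)))"
  proof (intro mult_left_mono sum_mono)
    fix z assume "z \<in> Z"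
    then have "(\<Sum>j\<in>J. (cmod (F j z))\<^sup>2) \<le> ?C * (\<Sum>x\<in>?L z. (cmod (b z x))\<^sup>2)"
      unfolding F_def by (intro eigenfunction_variance_bound J orth eigen b_mean)
    also have "\<dots> \<le> ?C * (4 * real N ^ CARD('d))"
      by (intro mult_left_mono b_norm) auto
    finally show "(\<Sum>j\<in>J. (cmod (F j z))\<^sup>2) \<le> ?C * (4 * real N ^ CARD('d))" .
  qed auto
  also have "\<dots> = real (card Z) ^ 2 * (?C * (4 * real N ^ CARD('d)))"
    by (simp add: power2_eq_square)
  also have "\<dots> \<le> real ?M ^ 2 * (?C * (4 * real N ^ CARD('d)))"
    using cardZ by (intro mult_right_mono power_mono) auto
  finally show ?thesis by (simp add: mult_ac)
qed

theorem theorem1p2: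
  fixes R :: nat
    and \<psi> :: "nat \<Rightarrow> nat \<Rightarrow> int ^ 'd::finite \<Rightarrow> complex"
    and K :: "nat \<Rightarrow> int ^ 'd \<Rightarrow> int ^ 'd \<Rightarrow> complex"
  assumes basis: "\<And>N. N \<ge> 1 \<Longrightarrow> is_orthonormal_basis N {1..N ^ CARD('d)} (\<psi> N)"
    and eigen: "\<And>N j. N \<ge> 1 \<Longrightarrow> j \<in> {1..N ^ CARD('d)} \<Longrightarrow> is_eigenfunction N (\<psi> N j)"
    and range: "\<And>N x y. N \<ge> 1 \<Longrightarrow> x \<in> box_lattice N \<Longrightarrow> y \<in> box_lattice N \<Longrightarrow>
                  l1_norm (x - y) > int R \<Longrightarrow> K N x y = 0"
    and bound: "\<And>N x y. N \<ge> 1 \<Longrightarrow> x \<in> box_lattice N \<Longrightarrow> y \<in> box_lattice N \<Longrightarrow>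
                  cmod (K N x y) \<le> 1"
  shows "(\<lambda>N. 1 / real N ^ CARD('d) *
            (\<Sum>j = 1..N ^ CARD('d).
               (cmod (box_inner N (\<psi> N j) (obs_apply N (K N) (\<psi> N j))
                      - correlator N (K N) (\<psi> N j)))\<^sup>2)) \<longlonglongrightarrow> 0
         \<and> (R = 0 \<longrightarrow>
             (\<forall>N\<ge>1. \<forall>j\<in>{1..N ^ CARD('d)}.
               correlator N (K N) (\<psi> N j) =
                 1 / of_nat (card (box_lattice N :: (int ^ 'd) set)) * (\<Sum>x\<in>box_lattice N. K N x x)))"
    (is "?V \<longlonglongrightarrow> 0 \<and> _")
proof (intro conjI impI allI ballI)
  have orth: "box_inner N (\<psi> N i) (\<psi> N j) = (if i = j then 1 else 0)"
    if "N \<ge> 1" "i \<in> {1..N ^ CARD('d)}" "j \<in> {1..N ^ CARD('d)}" for N i j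
    using basis[OF that(1)] that(2,3) unfolding is_orthonormal_basis_def by blast
  define C where "C = 4 * 8 ^ CARD('d) * real (card {z :: int ^ 'd. l1_norm z \<le> int R}) ^ 2"
  \<comment> \<open>\<open>C\<close> is independent of \<open>N\<close>, and averaging cancels the
    factor \<open>real N ^ CARD('d)\<close> of the variance bound.\<close>
  have V: "?V N \<le> C / real (N + 1)" if N: "N \<ge> 1" for N
  proof -
    have "?V N \<le> 1 / real N ^ CARD('d) * (C * real N ^ CARD('d) / real (N + 1))"
      unfolding C_def using N
      by (intro mult_left_mono quantum_variance_bound eigen bound range[of N] orth) simp_all
    also have "\<dots> = C / real (N + 1)" using N by simp
    finally show ?thesis .
  qed
  show "?V \<longlonglongrightarrow> 0"
  proof (rule tendsto_sandwich)
    show "eventually (\<lambda>N. 0 \<le> ?V N) sequentially"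
      by (intro always_eventually allI mult_nonneg_nonneg sum_nonneg) auto
    show "eventually (\<lambda>N. ?V N \<le> C / real (N + 1)) sequentially"
      using V by (auto simp: eventually_at_top_linorder)
    show "(\<lambda>N. C / real (N + 1)) \<longlonglongrightarrow> 0"
      using LIMSEQ_Suc[OF lim_const_over_n[of C]] by simp
  qed simp
  fix N j :: nat
  assume "R = 0" "N \<ge> 1" "j \<in> {1..N ^ CARD('d)}"
  then show "correlator N (K N) (\<psi> N j) =
      1 / of_nat (card (box_lattice N :: (int ^ 'd) set)) * (\<Sum>x\<in>box_lattice N. K N x x)"
  proof (intro correlator_diagonal)
    fix x y :: "int ^ 'd"
    assume xy: "x \<in> box_lattice N" "y \<in> box_lattice N" "x \<noteq> y"
    \<comment> \<open>Distinct lattice points are at positive distance, so for \<open>R = 0\<close>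
      the range condition removes every off-diagonal entry.\<close>
    then obtain i where "(x - y) $ i \<noteq> 0" by (auto simp: vec_eq_iff)
    with abs_le_l1_norm[of "x - y" i] have "l1_norm (x - y) > int R"
      using \<open>R = 0\<close> by linarith
    with \<open>N \<ge> 1\<close> xy show "K N x y = 0" by (intro range)
  qed (simp_all add: orth)
qed

end
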